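(* Let $D>0$, $\alpha,\beta>0$ with $\alpha^2\ge4\beta$, $q>1$, and let $h:(0,D)\to\mathbb{R}$ be a smooth decreasing function, antisymmetric around $D/2$, such that $\lim_{t\to0}t\,h(t)=j=-\lim_{t\to D}(D-t)h(t)$ for some positive integer $j$. If $u$ is a positive non-constant solution on $[0,D]$ of $$\varphi''''+2h\varphi'''+(2h'+h^2-\alpha)\varphi''+(h''+hh'-\alpha h)\varphi'+\beta(\varphi-\varphi^q)=0,$$ then $u(0)\ne1$, $u(D)\ne1$, and if $t\in[0,D]$ is a critical point of $u$ then $u''(t)\ne0$.
   Context: Antisymmetric around $D/2$ means $h(D/2+s)=-h(D/2-s)$ for $0\le s<D/2$. A solution of the fourth order equation on $[0,D]$ is a function $u\in C^4([0,D])$ satisfying it on $(0,D)$, with $u'(0)=u'''(0)=u'(D)=u'''(D)=0$, corresponding to a global solution of the equivalent first order system: $v_0=u$, $v_1=u'$, $v_2=u''+hu'$, $v_3=u'''+hu''+h'u'-\alpha u'$ extend continuously to $[0,D]$, satisfy $v_1=v_3=0$ at $0$ and $D$, and on $(0,D)$ solve $v_0'=v_1$, $v_1'=v_2-hv_1$, $v_2'=v_3+\alpha v_1$, $v_3'=\beta(v_0^q-v_0)-hv_3$. *)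

theory Defs
  imports "HOL-Analysis.Analysis"
begin

text \<open>
  Iterated derivative relative to a set. For \<open>S = {a..b}\<close> with \<open>a < b\<close> it is the ordinary
  iterated derivative at interior points and the one-sided one at \<open>a\<close> and \<open>b\<close>; the values
  of \<open>f\<close> outside \<open>S\<close> play no role for its values on \<open>S\<close>.
\<close>

primrec nth_deriv_within :: "real set \<Rightarrow> nat \<Rightarrow> (real \<Rightarrow> real) \<Rightarrow> real \<Rightarrow> real" where
  "nth_deriv_within S 0 f = f"
| "nth_deriv_within S (Suc k) f =
     (\<lambda>t. vector_derivative (nth_deriv_within S k f) (at t within S))"

definition C_k_on :: "nat \<Rightarrow> real set \<Rightarrow> (real \<Rightarrow> real) \<Rightarrow> bool" where
  "C_k_on k S f \<longleftrightarrow>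
     (\<forall>i<k. nth_deriv_within S i f differentiable_on S) \<and>
     continuous_on S (nth_deriv_within S k f)"

text \<open>Only for open \<open>S\<close>, since \<^const>\<open>deriv\<close> is the two-sided derivative.\<close>

definition smooth_on_open :: "real set \<Rightarrow> (real \<Rightarrow> real) \<Rightarrow> bool" where
  "smooth_on_open S f \<longleftrightarrow> open S \<and> (\<forall>k. (deriv ^^ k) f differentiable_on S)"

definition antisymmetric_around_midpoint :: "real \<Rightarrow> (real \<Rightarrow> real) \<Rightarrow> bool" where
  "antisymmetric_around_midpoint D h \<longleftrightarrow>
     (\<forall>s. 0 \<le> s \<and> s < D / 2 \<longrightarrow> h (D / 2 + s) = - h (D / 2 - s))"

definition fourth_order_equation_at ::
    "real \<Rightarrow> real \<Rightarrow> real \<Rightarrow> real \<Rightarrow> (real \<Rightarrow> real) \<Rightarrow> (real \<Rightarrow> real) \<Rightarrow> real \<Rightarrow> bool" where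
  "fourth_order_equation_at D \<alpha> \<beta> q h u t \<longleftrightarrow>
     (let u' = nth_deriv_within {0..D} 1 u; u'' = nth_deriv_within {0..D} 2 u;
          u''' = nth_deriv_within {0..D} 3 u; u'''' = nth_deriv_within {0..D} 4 u;
          h' = deriv h; h'' = deriv (deriv h)
      in u'''' t + 2 * h t * u''' t + (2 * h' t + (h t)\<^sup>2 - \<alpha>) * u'' t
         + (h'' t + h t * h' t - \<alpha> * h t) * u' t + \<beta> * (u t - u t powr q) = 0)"

text \<open>
  The functions \<open>v0, \<dots>, v3\<close> are the continuous extensions to \<open>[0,D]\<close> of the expressions in
  \<open>u\<close> and \<open>h\<close>, which are only meaningful on \<open>(0,D)\<close> because \<open>h\<close> blows up at the end points.
\<close>

definition global_system_solution ::
    "real \<Rightarrow> real \<Rightarrow> real \<Rightarrow> real \<Rightarrow> (real \<Rightarrow> real) \<Rightarrow> (real \<Rightarrow> real) \<Rightarrow> bool" where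
  "global_system_solution D \<alpha> \<beta> q h u \<longleftrightarrow>
     (let u' = nth_deriv_within {0..D} 1 u; u'' = nth_deriv_within {0..D} 2 u;
          u''' = nth_deriv_within {0..D} 3 u; h' = deriv h
      in \<exists>v0 v1 v2 v3.
        continuous_on {0..D} v0 \<and> continuous_on {0..D} v1 \<and>
        continuous_on {0..D} v2 \<and> continuous_on {0..D} v3 \<and>
        v1 0 = 0 \<and> v3 0 = 0 \<and> v1 D = 0 \<and> v3 D = 0 \<and>
        (\<forall>t\<in>{0<..<D}.
           v0 t = u t \<and>
           v1 t = u' t \<and>
           v2 t = u'' t + h t * u' t \<and>
           v3 t = u''' t + h t * u'' t + h' t * u' t - \<alpha> * u' t \<and>
           (v0 has_real_derivative v1 t) (at t) \<and>
           (v1 has_real_derivative v2 t - h t * v1 t) (at t) \<and>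
           (v2 has_real_derivative v3 t + \<alpha> * v1 t) (at t) \<and>
           (v3 has_real_derivative \<beta> * (v0 t powr q - v0 t) - h t * v3 t) (at t)))"

definition is_solution ::
    "real \<Rightarrow> real \<Rightarrow> real \<Rightarrow> real \<Rightarrow> (real \<Rightarrow> real) \<Rightarrow> (real \<Rightarrow> real) \<Rightarrow> bool" where
  "is_solution D \<alpha> \<beta> q h u \<longleftrightarrow>
     C_k_on 4 {0..D} u \<and>
     (\<forall>t\<in>{0<..<D}. fourth_order_equation_at D \<alpha> \<beta> q h u t) \<and>
     nth_deriv_within {0..D} 1 u 0 = 0 \<and> nth_deriv_within {0..D} 3 u 0 = 0 \<and>
     nth_deriv_within {0..D} 1 u D = 0 \<and> nth_deriv_within {0..D} 3 u D = 0 \<and>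
     global_system_solution D \<alpha> \<beta> q h u"

end

theory Submission
  imports Defs
begin

text \<open>
  Write \<open>L f = f'' + h f'\<close>. The equation is \<open>L (L u) - \<alpha> L u + \<beta> u = \<beta> u\<^sup>q\<close>, and since
  \<open>\<alpha>\<^sup>2 \<ge> 4 \<beta>\<close> it factors as \<open>(L - m) (L - l) u = \<beta> u\<^sup>q\<close> with \<open>l, m > 0\<close>, \<open>l + m = \<alpha>\<close>,
  \<open>l m = \<beta>\<close>. Fix a point \<open>a\<close>, put \<open>c = u a\<close>, \<open>y = u - c\<close> and \<open>z = L y - l y\<close>. Then
  \<open>L y = l y + z\<close> and \<open>L z = m z + \<beta> (u\<^sup>q - c)\<close>. If \<open>c \<ge> 1\<close>, the last term is nonnegative wherever
  \<open>y \<ge> 0\<close>, so this is a cooperative system: data at \<open>a\<close> with \<open>y, y', z, z' \<ge> 0\<close> stay nonnegative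
  on the whole of \<open>[a, D)\<close> (\<open>cooperative_system_nonneg\<close>). The friction term \<open>- h y'\<close> does no harm, even
  from \<open>a = 0\<close> where \<open>h\<close> blows up, because only a lower bound on \<open>h\<close> matters and \<open>h\<close> is decreasing.

  On \<open>[D/2, D)\<close> however \<open>h \<le> 0\<close>, so that \<open>y'' = l y + z - h y' \<ge> 0\<close> there; as \<open>y' \<ge> 0\<close> and
  \<open>y' = 0\<close> at \<open>D\<close>, this forces \<open>y' = 0\<close>, and the system then gives \<open>u = 1\<close> near \<open>D\<close>
  (\<open>equilibrium_at_right_end\<close>). Comparison in both directions from the end \<open>D\<close> shows that \<open>u = 1\<close>
  everywhere. If \<open>c \<le> 1\<close> and all four data are nonpositive the same argument applies to \<open>- y\<close> and
  \<open>- z\<close>; a sign \<open>s\<close> treats both cases at once. Because \<open>h\<close> is antisymmetric, the reflection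
  \<open>t \<mapsto> D - t\<close> preserves the system and reverses the signs of \<open>y'\<close> and \<open>z'\<close>.

  At a critical point with \<open>u'' = 0\<close> one has \<open>y = y' = z = 0\<close>, so only the signs of \<open>c - 1\<close> and of \<open>z'\<close>
  are left: the first one chooses \<open>s\<close> and the second one the direction in which to move.
  At an end point with \<open>u = 1\<close> one has \<open>y = y' = z' = 0\<close>, and \<open>s\<close> is chosen by the sign of \<open>z\<close>.
  In each case a non-constant \<open>u\<close> is impossible.
\<close>

section \<open>Comparison for cooperative systems with friction\<close>

text \<open>
  The squared negative part is continuously differentiable although the negative part is not; this
  makes a Gronwall estimate of negative parts possible.
\<close>

lemma has_real_derivative_min_0_squared:
  fixes f :: "real \<Rightarrow> real"
  assumes "(f has_real_derivative f') (at t)"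
  shows "((\<lambda>t. (min (f t) 0)\<^sup>2) has_real_derivative 2 * min (f t) 0 * f') (at t)"
proof -
  have "((\<lambda>x::real. (min x 0)\<^sup>2) has_real_derivative 2 * min x 0) (at x)" for x :: real
  proof -
    consider "x < 0" | "x > 0" | "x = 0" by linarith
    then show ?thesis
    proof cases
      case 1
      have "((\<lambda>x::real. x\<^sup>2) has_real_derivative 2 * min x 0) (at x)"
        using 1 by (auto intro!: derivative_eq_intros)
      then show ?thesis
        by (rule has_field_derivative_transform_within_open[where S = "{..<0}"]) (use 1 in auto)
    next
      case 2
      have "((\<lambda>x::real. 0) has_real_derivative 2 * min x 0) (at x)"
        using 2 by (auto intro!: derivative_eq_intros)
      then show ?thesis
        by (rule has_field_derivative_transform_within_open[where S = "{0<..}"]) (use 2 in auto)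
    next
      case 3
      have "((\<lambda>x::real. min x 0) \<longlongrightarrow> min 0 0) (at 0)"
        by (intro tendsto_intros)
      then have "((\<lambda>x::real. min x 0) \<longlongrightarrow> 0) (at 0)"
        by simp
      moreover have "\<forall>\<^sub>F x in at (0::real). min x 0 = ((min x 0)\<^sup>2 - (min 0 0)\<^sup>2) / (x - 0)"
        by (auto simp: eventually_at_filter min_def power2_eq_square)
      ultimately show ?thesis
        unfolding 3 has_field_derivative_iff by (auto intro: Lim_transform_eventually)
    qed
  qed
  from DERIV_chain2[OF this assms] show ?thesis .
qed

lemma gronwall_zero:
  fixes N N' :: "real \<Rightarrow> real"
  assumes "a \<le> b" "continuous_on {a..b} N"
    and "\<And>t. a < t \<Longrightarrow> t < b \<Longrightarrow> (N has_real_derivative N' t) (at t)"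
    and "\<And>t. a < t \<Longrightarrow> t < b \<Longrightarrow> N' t \<le> L * N t"
    and "N a \<le> 0"
  shows "N b \<le> 0"
proof (cases "a = b")
  case False
  then have "a < b" using assms by simp
  have "exp (- L * b) * N b \<le> exp (- L * a) * N a"
  proof (rule DERIV_nonpos_imp_decreasing_open[OF assms(1), where f = "\<lambda>t. exp (- L * t) * N t"])
    fix t assume t: "a < t" "t < b"
    have "((\<lambda>t. exp (- L * t) * N t) has_real_derivative exp (- L * t) * (N' t - L * N t)) (at t)"
      using assms(3)[OF t] by (auto intro!: derivative_eq_intros simp: algebra_simps)
    moreover have "exp (- L * t) * (N' t - L * N t) \<le> 0"
      using assms(4)[OF t] by (simp add: mult_le_0_iff)
    ultimately show "\<exists>y. ((\<lambda>t. exp (- L * t) * N t) has_real_derivative y) (at t) \<and> y \<le> 0"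
      by blast
  qed (intro continuous_intros assms)
  also have "\<dots> \<le> 0" using assms(5) by (simp add: mult_le_0_iff)
  finally show ?thesis by (simp add: mult_le_0_iff)
qed (use assms in simp)

text \<open>
  Let \<open>N\<close> be the sum of the squared negative parts of the four unknowns. All coupling terms have
  nonnegative coefficients, so in \<open>N'\<close> each coupling term \<open>min p 0 * r\<close> is at most
  \<open>min p 0 * min r 0\<close>; hence \<open>N' \<le> L * N\<close> and \<open>N\<close> stays zero. Friction enters only with the sign of
  \<open>- h\<close>, which is why a lower bound on \<open>h\<close> suffices and \<open>h\<close> may tend to infinity at \<open>a\<close>.
\<close>

lemma cooperative_system_nonneg:
  fixes y y1 z z1 g h :: "real \<Rightarrow> real"
  assumes "a \<le> b"
    and cont: "continuous_on {a..b} y" "continuous_on {a..b} y1"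
      "continuous_on {a..b} z" "continuous_on {a..b} z1"
    and deriv:
      "\<And>t. a < t \<Longrightarrow> t < b \<Longrightarrow> (y has_real_derivative y1 t) (at t)"
      "\<And>t. a < t \<Longrightarrow> t < b \<Longrightarrow> (y1 has_real_derivative l * y t + z t - h t * y1 t) (at t)"
      "\<And>t. a < t \<Longrightarrow> t < b \<Longrightarrow> (z has_real_derivative z1 t) (at t)"
      "\<And>t. a < t \<Longrightarrow> t < b \<Longrightarrow> (z1 has_real_derivative m * z t + g t - h t * z1 t) (at t)"
    and h: "\<And>t. a < t \<Longrightarrow> t < b \<Longrightarrow> - K \<le> h t"
    and g: "\<And>t. a < t \<Longrightarrow> t < b \<Longrightarrow> C * min (y t) 0 \<le> g t"
    and pos: "0 \<le> l" "0 \<le> m" "0 \<le> C" "0 \<le> K"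
    and init: "0 \<le> y a" "0 \<le> y1 a" "0 \<le> z a" "0 \<le> z1 a"
  shows "0 \<le> y b \<and> 0 \<le> y1 b \<and> 0 \<le> z b \<and> 0 \<le> z1 b"
proof -
  let ?n = "\<lambda>x::real. min x 0"
  define N where "N = (\<lambda>t. (?n (y t))\<^sup>2 + (?n (y1 t))\<^sup>2 + (?n (z t))\<^sup>2 + (?n (z1 t))\<^sup>2)"
  define N' where "N' = (\<lambda>t. 2 * ?n (y t) * y1 t + 2 * ?n (y1 t) * (l * y t + z t - h t * y1 t)
    + 2 * ?n (z t) * z1 t + 2 * ?n (z1 t) * (m * z t + g t - h t * z1 t))"
  define L where "L = 2 * K + l + m + C + 2"
  have "N b \<le> 0"
  proof (rule gronwall_zero[OF assms(1), of N N' L])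
    show "continuous_on {a..b} N"
      unfolding N_def by (intro continuous_intros cont)
    show "N a \<le> 0"
      using init by (simp add: N_def min_def)
    fix t assume t: "a < t" "t < b"
    show "(N has_real_derivative N' t) (at t)"
      unfolding N_def N'_def
      by (intro derivative_intros has_real_derivative_min_0_squared deriv t)
    have drop: "?n p * x \<le> ?n p * ?n x" for p x :: real
      by (rule mult_left_mono_neg) auto
    \<comment> \<open>Young's inequality, in the shape in which a coupling coefficient \<open>c\<close> multiplies the product.\<close>
    have amgm: "2 * (c * (p * r)) \<le> c * (p\<^sup>2 + r\<^sup>2)" if "0 \<le> c" for c p r :: real
      using mult_left_mono[OF sum_squares_bound[of p r] that] by (simp add: algebra_simps)
    have fric: "- (?n p * (h t * p)) \<le> K * (?n p)\<^sup>2" for p :: real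
    proof -
      have "?n p * p = (?n p)\<^sup>2" by (simp add: min_def power2_eq_square)
      then have "- (?n p * (h t * p)) = (- h t) * (?n p)\<^sup>2" by (simp add: algebra_simps)
      also have "\<dots> \<le> K * (?n p)\<^sup>2"
        using h[OF t] by (intro mult_right_mono) auto
      finally show ?thesis .
    qed
    have 1: "2 * (?n (y t) * y1 t) \<le> (?n (y t))\<^sup>2 + (?n (y1 t))\<^sup>2"
      using drop[of "y t" "y1 t"] sum_squares_bound[of "?n (y t)" "?n (y1 t)"]
      by (simp add: mult.assoc)
    have 2: "2 * (l * (?n (y1 t) * y t)) \<le> l * ((?n (y1 t))\<^sup>2 + (?n (y t))\<^sup>2)"
      using mult_left_mono[OF drop[of "y1 t" "y t"] pos(1)] amgm[OF pos(1), of "?n (y1 t)" "?n (y t)"]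
      by linarith
    have 3: "2 * (?n (y1 t) * z t) \<le> (?n (y1 t))\<^sup>2 + (?n (z t))\<^sup>2"
      using drop[of "y1 t" "z t"] sum_squares_bound[of "?n (y1 t)" "?n (z t)"]
      by (simp add: mult.assoc)
    have 4: "2 * (?n (z t) * z1 t) \<le> (?n (z t))\<^sup>2 + (?n (z1 t))\<^sup>2"
      using drop[of "z t" "z1 t"] sum_squares_bound[of "?n (z t)" "?n (z1 t)"]
      by (simp add: mult.assoc)
    have 5: "2 * (m * (?n (z1 t) * z t)) \<le> m * ((?n (z1 t))\<^sup>2 + (?n (z t))\<^sup>2)"
      using mult_left_mono[OF drop[of "z1 t" "z t"] pos(2)] amgm[OF pos(2), of "?n (z1 t)" "?n (z t)"]
      by linarith
    have "?n (z1 t) * g t \<le> ?n (z1 t) * (C * ?n (y t))"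
      by (rule mult_left_mono_neg[OF g[OF t]]) simp
    then have 6: "2 * (?n (z1 t) * g t) \<le> C * ((?n (z1 t))\<^sup>2 + (?n (y t))\<^sup>2)"
      using amgm[OF pos(3), of "?n (z1 t)" "?n (y t)"] by (simp add: algebra_simps)
    have collect: "(A + B) + l * (B + A) + (B + E) + (E + F) + m * (F + E) + C * (F + A)
        + 2 * (K * B) + 2 * (K * F) \<le> L * (A + B + E + F)"
      if "0 \<le> A" "0 \<le> B" "0 \<le> E" "0 \<le> F" for A B E F
    proof -
      have "0 \<le> (2 * K + m + 1) * A" "0 \<le> (m + C) * B"
        "0 \<le> (2 * K + l + C) * E" "0 \<le> (l + 1) * F"
        using pos that by auto
      then show ?thesis unfolding L_def by (simp add: algebra_simps)
    qed
    have "N' t = 2 * (?n (y t) * y1 t) + 2 * (l * (?n (y1 t) * y t)) + 2 * (?n (y1 t) * z t)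
        + 2 * (?n (z t) * z1 t) + 2 * (m * (?n (z1 t) * z t)) + 2 * (?n (z1 t) * g t)
        + 2 * (- (?n (y1 t) * (h t * y1 t))) + 2 * (- (?n (z1 t) * (h t * z1 t)))"
      by (simp add: N'_def algebra_simps)
    also have "\<dots> \<le> ((?n (y t))\<^sup>2 + (?n (y1 t))\<^sup>2) + l * ((?n (y1 t))\<^sup>2 + (?n (y t))\<^sup>2)
        + ((?n (y1 t))\<^sup>2 + (?n (z t))\<^sup>2) + ((?n (z t))\<^sup>2 + (?n (z1 t))\<^sup>2)
        + m * ((?n (z1 t))\<^sup>2 + (?n (z t))\<^sup>2) + C * ((?n (z1 t))\<^sup>2 + (?n (y t))\<^sup>2)
        + 2 * (K * (?n (y1 t))\<^sup>2) + 2 * (K * (?n (z1 t))\<^sup>2)"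
      using 1 2 3 4 5 6 fric[of "y1 t"] fric[of "z1 t"] by linarith
    also have "\<dots> \<le> L * N t"
      unfolding N_def by (rule collect) auto
    finally show "N' t \<le> L * N t" .
  qed
  moreover have "0 \<le> (?n (y b))\<^sup>2" "0 \<le> (?n (y1 b))\<^sup>2" "0 \<le> (?n (z b))\<^sup>2" "0 \<le> (?n (z1 b))\<^sup>2"
    by auto
  ultimately have "(?n (y b))\<^sup>2 = 0" "(?n (y1 b))\<^sup>2 = 0" "(?n (z b))\<^sup>2 = 0" "(?n (z1 b))\<^sup>2 = 0"
    unfolding N_def by linarith+
  then have "?n (y b) = 0" "?n (y1 b) = 0" "?n (z b) = 0" "?n (z1 b) = 0"
    by (simp_all only: power_eq_0_iff)
  then show ?thesis by linarith
qed

section \<open>The factored system\<close>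

lemma powr_difference_bound:
  fixes x c M q :: real
  assumes "0 < x" "x \<le> M" "0 < c" "c \<le> M" "1 < q"
  shows "\<exists>k. 0 \<le> k \<and> k \<le> q * M powr (q - 1) \<and> x powr q - c powr q = k * (x - c)"
proof -
  have *: "\<exists>k. 0 \<le> k \<and> k \<le> q * M powr (q - 1) \<and> x powr q - c powr q = k * (x - c)"
    if "c < x" "0 < c" "x \<le> M" for x c
  proof -
    have "\<exists>\<xi>. c < \<xi> \<and> \<xi> < x \<and> x powr q - c powr q = (x - c) * (q * \<xi> powr (q - 1))"
      by (rule MVT2) (use that in \<open>auto intro!: derivative_eq_intros\<close>)
    then obtain \<xi> where "c < \<xi>" "\<xi> < x" "x powr q - c powr q = (x - c) * (q * \<xi> powr (q - 1))"
      by blast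
    moreover from this have "q * \<xi> powr (q - 1) \<le> q * M powr (q - 1)"
      using that assms(5) by (intro mult_left_mono powr_mono2) auto
    ultimately show ?thesis
      using assms(5) by (intro exI[of _ "q * \<xi> powr (q - 1)"]) auto
  qed
  consider "c < x" | "x < c" | "x = c" by linarith
  then show ?thesis
  proof cases
    case 2
    obtain k where "0 \<le> k" "k \<le> q * M powr (q - 1)" "c powr q - x powr q = k * (c - x)"
      using *[of x c] 2 assms by blast
    then show ?thesis by (intro exI[of _ k]) (auto simp: algebra_simps)
  qed (use * assms in auto)
qed

text \<open>
  The first order system with \<open>\<alpha> = l + m\<close> and \<open>\<beta> = l * m\<close>. As a locale it can be interpreted a
  second time by its own reflection, which turns every statement about moving right from a point
  into one about moving left.
\<close>

locale singular_system =
  fixes D l m q :: real and h v0 v1 v2 v3 :: "real \<Rightarrow> real"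
  assumes D: "0 < D" and l: "0 < l" and m: "0 < m" and q: "1 < q"
    and h_anti: "antimono_on {0<..<D} h"
    and h_odd: "\<And>t. 0 < t \<Longrightarrow> t < D \<Longrightarrow> h (D - t) = - h t"
    and cont: "continuous_on {0..D} v0" "continuous_on {0..D} v1"
      "continuous_on {0..D} v2" "continuous_on {0..D} v3"
    and v1_0: "v1 0 = 0" and v1_D: "v1 D = 0"
    and v0_pos: "\<And>t. 0 \<le> t \<Longrightarrow> t \<le> D \<Longrightarrow> 0 < v0 t"
    and deriv:
      "\<And>t. 0 < t \<Longrightarrow> t < D \<Longrightarrow> (v0 has_real_derivative v1 t) (at t)"
      "\<And>t. 0 < t \<Longrightarrow> t < D \<Longrightarrow> (v1 has_real_derivative v2 t - h t * v1 t) (at t)"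
      "\<And>t. 0 < t \<Longrightarrow> t < D \<Longrightarrow> (v2 has_real_derivative v3 t + (l + m) * v1 t) (at t)"
      "\<And>t. 0 < t \<Longrightarrow> t < D \<Longrightarrow> (v3 has_real_derivative l * m * (v0 t powr q - v0 t) - h t * v3 t) (at t)"
begin

lemma h_nonpos: "h t \<le> 0" if "D / 2 \<le> t" "t < D"
proof -
  have "h (D / 2) = 0" using h_odd[of "D / 2"] D by simp
  moreover have "h t \<le> h (D / 2)"
    using h_anti that D unfolding monotone_on_def by simp
  ultimately show ?thesis by simp
qed

lemma reflected:
  "singular_system D l m q h (\<lambda>t. v0 (D - t)) (\<lambda>t. - v1 (D - t)) (\<lambda>t. v2 (D - t)) (\<lambda>t. - v3 (D - t))"
proof
  have r: "continuous_on {0..D} (\<lambda>t. f (D - t))" if "continuous_on {0..D} f" for f :: "real \<Rightarrow> real"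
    by (rule continuous_on_compose2[OF that]) (auto intro!: continuous_intros)
  show "continuous_on {0..D} (\<lambda>t. v0 (D - t))" "continuous_on {0..D} (\<lambda>t. - v1 (D - t))"
    "continuous_on {0..D} (\<lambda>t. v2 (D - t))" "continuous_on {0..D} (\<lambda>t. - v3 (D - t))"
    by (intro continuous_intros r cont)+
  fix t assume t: "0 < t" "t < D"
  have c: "((\<lambda>t. f (D - t)) has_real_derivative - f') (at t)"
    if "(f has_real_derivative f') (at (D - t))" for f f'
  proof -
    have "((\<lambda>t. D - t) has_real_derivative -1) (at t)"
      by (auto intro!: derivative_eq_intros)
    from DERIV_chain2[of f f' "\<lambda>t. D - t" t "-1" UNIV, OF that this] show ?thesis
      by simp
  qed
  have t': "0 < D - t" "D - t < D" using t by auto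
  show "((\<lambda>t. v0 (D - t)) has_real_derivative - v1 (D - t)) (at t)"
    using c[OF deriv(1)[OF t']] .
  show "((\<lambda>t. - v1 (D - t)) has_real_derivative v2 (D - t) - h t * - v1 (D - t)) (at t)"
    using DERIV_minus[OF c[OF deriv(2)[OF t']]] h_odd[OF t] by (simp add: add.commute)
  show "((\<lambda>t. v2 (D - t)) has_real_derivative - v3 (D - t) + (l + m) * - v1 (D - t)) (at t)"
    using c[OF deriv(3)[OF t']] by simp
  show "((\<lambda>t. - v3 (D - t)) has_real_derivative
      l * m * (v0 (D - t) powr q - v0 (D - t)) - h t * - v3 (D - t)) (at t)"
    using DERIV_minus[OF c[OF deriv(4)[OF t']]] h_odd[OF t] by (simp add: add.commute)
qed (use D l m q h_anti h_odd v1_0 v1_D v0_pos in auto)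

text \<open>
  In the variables \<open>y = s (v0 - v0 a)\<close>, \<open>s v1\<close>, \<open>z = s (v2 - l (v0 - v0 a))\<close> and \<open>s (v3 + m v1) = z'\<close>
  the system is cooperative. The base value is \<open>v0 a\<close> rather than \<open>1\<close> so that \<open>y\<close> and \<open>z\<close> start
  from zero and from \<open>s v2 a\<close>; the price is the source \<open>l m s (v0\<^sup>q - v0 a)\<close>, which is nonnegative
  for \<open>y \<ge> 0\<close> because \<open>s (v0 a - 1) \<ge> 0\<close>.
\<close>

lemma nonneg_forward:
  assumes a: "0 \<le> a" "a \<le> b" "b < D" and s: "s = 1 \<or> s = -1"
    and init: "v1 a = 0" "0 \<le> s * (v0 a - 1)" "0 \<le> s * v2 a" "0 \<le> s * v3 a"
  shows "0 \<le> s * (v0 b - v0 a) \<and> 0 \<le> s * v1 b \<and>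
    0 \<le> s * (v2 b - l * (v0 b - v0 a)) \<and> 0 \<le> s * (v3 b + m * v1 b)"
proof (cases "a = b")
  case False
  let ?c = "v0 a"
  obtain M where M: "\<And>t. t \<in> {0..D} \<Longrightarrow> v0 t \<le> M"
    using continuous_attains_sup[OF compact_Icc _ cont(1)] D by fastforce
  \<comment> \<open>A Lipschitz constant on \<open>(0, M]\<close> for the nonlinearity; it controls the source where \<open>y < 0\<close>.\<close>
  define C where "C = l * m * (q * M powr (q - 1))"
  have c: "0 < ?c" "?c \<le> M" using v0_pos[of a] M[of a] a by auto
  have sub: "continuous_on {a..b} f" if "continuous_on {0..D} f" for f :: "real \<Rightarrow> real"
    using that by (rule continuous_on_subset) (use a in auto)
  have cq: "0 \<le> s * (?c powr q - ?c)"
  proof -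
    have "?c powr q = ?c * ?c powr (q - 1)" using c by (simp add: powr_diff)
    then have e: "?c powr q - ?c = ?c * (?c powr (q - 1) - 1)" by (simp add: algebra_simps)
    from s show ?thesis
    proof
      assume "s = 1"
      then show ?thesis using init(2) c q unfolding e by (simp add: ge_one_powr_ge_zero)
    next
      assume "s = -1"
      moreover from this have "?c powr (q - 1) \<le> 1" using init(2) c q by (simp add: powr_le1)
      ultimately show ?thesis using c unfolding e by (simp add: mult_le_0_iff)
    qed
  qed
  show ?thesis
  proof (rule cooperative_system_nonneg[where h = h and l = l and m = m and C = C and K = "\<bar>h b\<bar>"
        and y = "\<lambda>t. s * (v0 t - ?c)" and z = "\<lambda>t. s * (v2 t - l * (v0 t - ?c))"
        and g = "\<lambda>t. s * (l * m * (v0 t powr q - ?c))" and a = a])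
    show "a \<le> b" by fact
    show "continuous_on {a..b} (\<lambda>t. s * (v0 t - ?c))" "continuous_on {a..b} (\<lambda>t. s * v1 t)"
      "continuous_on {a..b} (\<lambda>t. s * (v2 t - l * (v0 t - ?c)))"
      "continuous_on {a..b} (\<lambda>t. s * (v3 t + m * v1 t))"
      by (intro continuous_intros sub cont)+
    show "0 \<le> l" "0 \<le> m" "0 \<le> \<bar>h b\<bar>" "0 \<le> C" using l m q by (auto simp: C_def)
    show "0 \<le> s * (?c - ?c)" "0 \<le> s * v1 a" "0 \<le> s * (v2 a - l * (?c - ?c))"
      "0 \<le> s * (v3 a + m * v1 a)" using init by auto
    fix t assume "a < t" "t < b"
    then have t: "0 < t" "t < D" and tb: "t < b" using a by auto
    show "((\<lambda>t. s * (v0 t - ?c)) has_real_derivative s * v1 t) (at t)"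
      using deriv(1)[OF t] by (auto intro!: derivative_eq_intros)
    show "((\<lambda>t. s * v1 t) has_real_derivative
        l * (s * (v0 t - ?c)) + s * (v2 t - l * (v0 t - ?c)) - h t * (s * v1 t)) (at t)"
      using deriv(2)[OF t] by (auto intro!: derivative_eq_intros simp: algebra_simps)
    show "((\<lambda>t. s * (v2 t - l * (v0 t - ?c))) has_real_derivative s * (v3 t + m * v1 t)) (at t)"
      using deriv(1,3)[OF t] by (auto intro!: derivative_eq_intros simp: algebra_simps)
    show "((\<lambda>t. s * (v3 t + m * v1 t)) has_real_derivative
        m * (s * (v2 t - l * (v0 t - ?c))) + s * (l * m * (v0 t powr q - ?c))
        - h t * (s * (v3 t + m * v1 t))) (at t)"
      using deriv(2,4)[OF t] by (auto intro!: derivative_eq_intros simp: algebra_simps)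
    have "h b \<le> h t" using h_anti t tb a unfolding monotone_on_def by auto
    then show "- \<bar>h b\<bar> \<le> h t" by linarith
    obtain k where k: "0 \<le> k" "k \<le> q * M powr (q - 1)"
        "v0 t powr q - ?c powr q = k * (v0 t - ?c)"
      using powr_difference_bound[of "v0 t" M ?c q] v0_pos[of t] M[of t] c q t by auto
    have "q * M powr (q - 1) * min (s * (v0 t - ?c)) 0 \<le> k * min (s * (v0 t - ?c)) 0"
      using k by (intro mult_right_mono_neg) auto
    also have "\<dots> \<le> k * (s * (v0 t - ?c))"
      using k by (intro mult_left_mono) auto
    also have "\<dots> = s * (v0 t powr q - ?c powr q)"
      unfolding k(3) by simp
    also have "\<dots> \<le> s * (v0 t powr q - ?c)"
      using cq by (simp add: algebra_simps)
    finally have "(l * m) * (q * M powr (q - 1) * min (s * (v0 t - ?c)) 0)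
        \<le> (l * m) * (s * (v0 t powr q - ?c))"
      using l m by (intro mult_left_mono) auto
    then show "C * min (s * (v0 t - ?c)) 0 \<le> s * (l * m * (v0 t powr q - ?c))"
      by (simp add: C_def algebra_simps)
  qed
qed (use init in auto)

text \<open>
  Uniqueness at the singular end point needs no separate argument: equilibrium data satisfy the
  comparison hypotheses for both signs, so \<open>1\<close> bounds \<open>v0\<close> from below and from above.
\<close>

lemma equilibrium_of_initial_equilibrium:
  assumes "v0 0 = 1" "v2 0 = 0" "v3 0 = 0" "t \<in> {0..D}"
  shows "v0 t = 1"
proof -
  have "v0 b = 1" if "0 \<le> b" "b < D" for b
    using nonneg_forward[of 0 b 1] nonneg_forward[of 0 b "-1"] that assms v1_0 by auto
  then have "v0 constant_on {0..<D}"
    by (auto simp: constant_on_def)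
  then have "v0 constant_on closure {0..<D}"
    by (rule constant_on_closureI) (use D cont in simp)
  then show ?thesis
    using assms D by (auto simp: constant_on_def)
qed

text \<open>
  To the right of \<open>D / 2\<close> the friction has become a driving term, so \<open>s v1\<close> is nonnegative and
  nondecreasing and yet must vanish at \<open>D\<close>. Once it is identically zero, the equations give
  \<open>v2 = 0\<close>, \<open>v3 = 0\<close> and \<open>v0\<^sup>q = v0\<close> one after another.
\<close>

lemma equilibrium_at_right_end:
  assumes a: "0 \<le> a" "a < D" and s: "s = 1 \<or> s = -1"
    and init: "v1 a = 0" "0 \<le> s * (v0 a - 1)" "0 \<le> s * v2 a" "0 \<le> s * v3 a"
  shows "v0 D = 1 \<and> v2 D = 0 \<and> v3 D = 0"
proof -
  define r where "r = max a (D / 2)"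
  have r: "a \<le> r" "D / 2 \<le> r" "0 < r" "r < D" using a D by (auto simp: r_def)
  let ?c = "v0 a"
  note nn = nonneg_forward[OF a(1) _ _ s init]
  have v1_nonpos: "s * v1 t \<le> 0" if t: "r \<le> t" "t < D" for t
  proof -
    have "s * v1 t \<le> s * v1 D"
    proof (rule DERIV_nonneg_imp_increasing_open[where f = "\<lambda>t. s * v1 t"])
      show "continuous_on {t..D} (\<lambda>t. s * v1 t)"
        by (intro continuous_intros continuous_on_subset[OF cont(2)]) (use t r in auto)
      fix x assume x: "t < x" "x < D"
      have "((\<lambda>t. s * v1 t) has_real_derivative s * (v2 x - h x * v1 x)) (at x)"
        using deriv(2)[of x] x t r by (auto intro!: derivative_eq_intros)
      moreover have "0 \<le> s * (v2 x - h x * v1 x)"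
      proof -
        have p: "0 \<le> s * (v0 x - ?c)" "0 \<le> s * v1 x" "0 \<le> s * (v2 x - l * (v0 x - ?c))"
          using nn[of x] x t r by auto
        have "h x \<le> 0" using h_nonpos x t r by auto
        then have "h x * (s * v1 x) \<le> 0" using p(2) by (simp add: mult_le_0_iff)
        moreover have "0 \<le> l * (s * (v0 x - ?c))" using p l by simp
        ultimately show ?thesis using p(3) by (simp add: algebra_simps)
      qed
      ultimately show "\<exists>y. ((\<lambda>t. s * v1 t) has_real_derivative y) (at x) \<and> 0 \<le> y" by blast
    qed (use t in auto)
    then show ?thesis using v1_D by simp
  qed
  have z0: "f' = 0" if "(f has_real_derivative f') (at t)" "\<And>x. r < x \<Longrightarrow> x < D \<Longrightarrow> f x = c" "r < t" "t < D"
    for f f' c t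
  proof -
    have "((\<lambda>x. c) has_real_derivative f') (at t)"
      by (rule has_field_derivative_transform_within_open[OF that(1), where S = "{r<..<D}"])
        (use that in auto)
    then show ?thesis using DERIV_const DERIV_unique by blast
  qed
  have v1z: "v1 t = 0" if "r < t" "t < D" for t
    using nn[of t] v1_nonpos[of t] that r s by auto
  have v2z: "v2 t = 0" if "r < t" "t < D" for t
    using z0[OF deriv(2)[of t] v1z] v1z[OF that] that r by auto
  have v3z: "v3 t = 0" if "r < t" "t < D" for t
    using z0[OF deriv(3)[of t] v2z] v1z[OF that] that r by auto
  have v0z: "v0 t = 1" if t: "r < t" "t < D" for t
  proof -
    have "v0 t powr q = v0 t"
      using z0[OF deriv(4)[of t] v3z] v3z[OF t] t r l m by auto
    then show ?thesis
      using powr_inj[of "v0 t" q 1] q v0_pos[of t] t r by auto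
  qed
  have lim: "f D = c" if "continuous_on {0..D} f" "\<And>t. r < t \<Longrightarrow> t < D \<Longrightarrow> f t = c"
    for f :: "real \<Rightarrow> real" and c
  proof -
    have "f constant_on closure {r<..<D}"
      by (rule constant_on_closureI)
         (use that r in \<open>auto simp: constant_on_def intro: continuous_on_subset\<close>)
    moreover have "f ((r + D) / 2) = c" using that(2) r by simp
    ultimately show ?thesis using r by (auto simp: constant_on_def)
  qed
  show ?thesis using lim[OF cont(1) v0z] lim[OF cont(3) v2z] lim[OF cont(4) v3z] by blast
qed

text \<open>
  The equilibrium reached at \<open>D\<close> spreads back over the whole interval, as the initial equilibrium
  of the reflected solution.
\<close>

lemma equilibrium_forward:
  assumes "0 \<le> a" "a < D" "s = 1 \<or> s = -1"
    and "v1 a = 0" "0 \<le> s * (v0 a - 1)" "0 \<le> s * v2 a" "0 \<le> s * v3 a"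
    and "t \<in> {0..D}"
  shows "v0 t = 1"
proof -
  interpret r: singular_system D l m q h "\<lambda>t. v0 (D - t)" "\<lambda>t. - v1 (D - t)" "\<lambda>t. v2 (D - t)"
    "\<lambda>t. - v3 (D - t)" by (rule reflected)
  show ?thesis
    using r.equilibrium_of_initial_equilibrium[of "D - t"] equilibrium_at_right_end[OF assms(1-7)]
      assms(8) by auto
qed

lemma equilibrium_backward:
  assumes "0 < a" "a \<le> D" "s = 1 \<or> s = -1"
    and "v1 a = 0" "0 \<le> s * (v0 a - 1)" "0 \<le> s * v2 a" "s * v3 a \<le> 0"
    and "t \<in> {0..D}"
  shows "v0 t = 1"
proof -
  interpret r: singular_system D l m q h "\<lambda>t. v0 (D - t)" "\<lambda>t. - v1 (D - t)" "\<lambda>t. v2 (D - t)"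
    "\<lambda>t. - v3 (D - t)" by (rule reflected)
  show ?thesis
    using r.equilibrium_forward[of "D - a" s "D - t"] assms by auto
qed

end

section \<open>End points and critical points\<close>

text \<open>
  At an end point \<open>h\<close> is singular, but \<open>h t * f t\<close> is \<open>(t - p) h t\<close> times the difference quotient of
  \<open>f\<close>, so that \<open>f' + h f\<close> tends to \<open>(1 + k) f' p\<close>. With \<open>f = u'\<close> this transfers \<open>u'' = 0\<close> at an
  end point to \<open>v2 = 0\<close>.
\<close>

lemma radial_laplacian_zero:
  fixes f f' h v :: "real \<Rightarrow> real"
  assumes "(f has_real_derivative f' p) (at p within {0..D})" "f p = 0" "f' p = 0"
    and "continuous_on {0..D} f'" "continuous_on {0..D} v"
    and "p \<in> {0..D}" "0 < D"
    and "((\<lambda>t. (t - p) * h t) \<longlongrightarrow> k) (at p within {0<..<D})"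
    and "\<And>t. t \<in> {0<..<D} - {p} \<Longrightarrow> v t = f' t + h t * f t"
  shows "v p = 0"
proof -
  let ?F = "at p within {0<..<D}"
  have F: "?F \<le> at p within {0..D}" by (rule at_le) auto
  have "((\<lambda>t. (f t - f p) / (t - p)) \<longlongrightarrow> f' p) ?F"
    by (rule tendsto_mono[OF F]) (use assms(1) in \<open>simp add: has_field_derivative_iff\<close>)
  then have "((\<lambda>t. (f t - f p) / (t - p) * ((t - p) * h t)) \<longlongrightarrow> f' p * k) ?F"
    using assms(8) by (intro tendsto_mult)
  moreover have "(f' \<longlongrightarrow> f' p) ?F"
    by (rule tendsto_mono[OF F]) (use assms(4,6) in \<open>auto simp: continuous_on_def\<close>)
  ultimately have "((\<lambda>t. f' t + (f t - f p) / (t - p) * ((t - p) * h t)) \<longlongrightarrow> f' p + f' p * k) ?F"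
    by (intro tendsto_add)
  moreover have "\<forall>\<^sub>F t in ?F. f' t + (f t - f p) / (t - p) * ((t - p) * h t) = v t"
    using assms(2,9) by (auto simp: eventually_at_filter)
  ultimately have "(v \<longlongrightarrow> f' p + f' p * k) ?F"
    by (rule Lim_transform_eventually)
  then have "(v \<longlongrightarrow> 0) ?F"
    using assms(3) by simp
  moreover have "(v \<longlongrightarrow> v p) ?F"
    by (rule tendsto_mono[OF F]) (use assms(5,6) in \<open>auto simp: continuous_on_def\<close>)
  moreover have "?F \<noteq> bot"
  proof (cases "p < D")
    case True
    then have "p islimpt {p<..<D}" by (rule islimpt_greaterThanLessThan1)
    then have "p islimpt {0<..<D}" by (rule islimpt_subset) (use assms(6) in auto)
    then show ?thesis by (simp add: trivial_limit_within)
  next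
    case False
    then show ?thesis
      using assms(6,7) islimpt_greaterThanLessThan2[of 0 D] by (simp add: trivial_limit_within)
  qed
  ultimately show ?thesis using tendsto_unique by blast
qed

theorem theorem3p15:
  fixes D \<alpha> \<beta> q :: real and h u :: "real \<Rightarrow> real" and j :: nat
  assumes "D > 0" and "\<alpha> > 0" and "\<beta> > 0" and "\<alpha>\<^sup>2 \<ge> 4 * \<beta>" and "q > 1"
    and "smooth_on_open {0<..<D} h"
    and "antimono_on {0<..<D} h"
    and "antisymmetric_around_midpoint D h"
    and "j > 0"
    and "((\<lambda>t. t * h t) \<longlongrightarrow> real j) (at_right 0)"
    and "((\<lambda>t. (D - t) * h t) \<longlongrightarrow> - real j) (at_left D)"
    and "is_solution D \<alpha> \<beta> q h u"
    and "\<forall>t\<in>{0..D}. u t > 0"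
    and "\<not> u constant_on {0..D}"
  shows "u 0 \<noteq> 1 \<and> u D \<noteq> 1 \<and>
         (\<forall>t\<in>{0..D}. nth_deriv_within {0..D} 1 u t = 0 \<longrightarrow> nth_deriv_within {0..D} 2 u t \<noteq> 0)"
proof -
  let ?d = "\<lambda>k. nth_deriv_within {0..D} k u"
  \<comment> \<open>\<open>l\<close> and \<open>m\<close> are the roots of \<open>X\<^sup>2 - \<alpha> X + \<beta>\<close>.\<close>
  define w where "w = sqrt (\<alpha>\<^sup>2 - 4 * \<beta>)"
  define l where "l = (\<alpha> + w) / 2"
  define m where "m = (\<alpha> - w) / 2"
  have w: "0 \<le> w" "w\<^sup>2 = \<alpha>\<^sup>2 - 4 * \<beta>" using assms by (auto simp: w_def)
  have "w < \<alpha>" by (rule power2_less_imp_less) (use w assms in auto)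
  then have lm: "0 < l" "0 < m" "l + m = \<alpha>" "l * m = \<beta>"
    using w assms(2) by (auto simp: l_def m_def field_simps power2_eq_square)
  have Ck: "C_k_on 4 {0..D} u"
    and gs: "global_system_solution D \<alpha> \<beta> q h u"
    using assms(12) by (auto simp: is_solution_def)
  obtain v0 v1 v2 v3 where cont: "continuous_on {0..D} v0" "continuous_on {0..D} v1"
      "continuous_on {0..D} v2" "continuous_on {0..D} v3"
    and v13: "v1 0 = 0" "v3 0 = 0" "v1 D = 0" "v3 D = 0"
    and system: "\<forall>t\<in>{0<..<D}. v0 t = u t \<and>
           v1 t = ?d 1 t \<and>
           v2 t = ?d 2 t + h t * ?d 1 t \<and>
           v3 t = ?d 3 t + h t * ?d 2 t + deriv h t * ?d 1 t - \<alpha> * ?d 1 t \<and>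
           (v0 has_real_derivative v1 t) (at t) \<and>
           (v1 has_real_derivative v2 t - h t * v1 t) (at t) \<and>
           (v2 has_real_derivative v3 t + \<alpha> * v1 t) (at t) \<and>
           (v3 has_real_derivative \<beta> * (v0 t powr q - v0 t) - h t * v3 t) (at t)"
    using gs unfolding global_system_solution_def Let_def by blast
  note vt = bspec[OF system, unfolded greaterThanLessThan_iff, OF conjI]
  have diff: "?d k differentiable_on {0..D}" if "k < 4" for k
    using Ck that by (simp add: C_k_on_def)
  have v0u: "v0 t = u t" if "t \<in> {0..D}" for t
  proof -
    have "continuous_on {0..D} u"
      using diff[of 0] by (simp add: differentiable_imp_continuous_on)
    then have c: "continuous_on (closure {0<..<D}) (\<lambda>t. v0 t - u t)"
      using cont(1) assms(1) by (simp add: continuous_on_diff)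
    have "v0 x - u x = 0" if "x \<in> {0<..<D}" for x
      using vt(1)[of x] that by (simp del: One_nat_def)
    from continuous_constant_on_closure[OF c this, of t] show ?thesis
      using that assms(1) by simp
  qed
  interpret singular_system D l m q h v0 v1 v2 v3
  proof
    fix t assume t: "0 < t" "t < D"
    have odd: "h (D / 2 + r) = - h (D / 2 - r)" if "0 \<le> r" "r < D / 2" for r
      using assms(8) that by (simp add: antisymmetric_around_midpoint_def)
    show "h (D - t) = - h t"
    proof (cases "t \<le> D / 2")
      case True
      then show ?thesis using odd[of "D / 2 - t"] t by simp
    next
      case False
      then show ?thesis using odd[of "t - D / 2"] t by simp
    qed
  next
    fix t assume t: "0 < t" "t < D"
    show "(v0 has_real_derivative v1 t) (at t)"
      "(v1 has_real_derivative v2 t - h t * v1 t) (at t)"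
      "(v2 has_real_derivative v3 t + (l + m) * v1 t) (at t)"
      "(v3 has_real_derivative l * m * (v0 t powr q - v0 t) - h t * v3 t) (at t)"
      unfolding lm(3,4) using vt[OF t] by blast+
  qed (use assms(1,5,7,13) lm cont v13 v0u in auto)
  have no: "\<not> (\<forall>t\<in>{0..D}. v0 t = 1)"
    using assms(14) v0u by (auto simp: constant_on_def)
  have sgn: "\<exists>s::real. (s = 1 \<or> s = -1) \<and> 0 \<le> s * x" for x
  proof (cases "0 \<le> x")
    case True
    then show ?thesis by (intro exI[of _ 1]) auto
  next
    case False
    then show ?thesis by (intro exI[of _ "-1"]) auto
  qed
  have "u 0 \<noteq> 1"
  proof
    assume "u 0 = 1"
    moreover obtain s :: real where "s = 1 \<or> s = -1" "0 \<le> s * v2 0" using sgn by blast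
    ultimately show False
      using equilibrium_forward[of 0 s] v13 v0u[of 0] assms(1) no by auto
  qed
  moreover have "u D \<noteq> 1"
  proof
    assume "u D = 1"
    moreover obtain s :: real where "s = 1 \<or> s = -1" "0 \<le> s * v2 D" using sgn by blast
    ultimately show False
      using equilibrium_backward[of D s] v13 v0u[of D] assms(1) no by auto
  qed
  moreover have "?d 2 t \<noteq> 0" if t: "t \<in> {0..D}" "?d 1 t = 0" for t
  proof
    assume d2: "?d 2 t = 0"
    have v1t: "v1 t = 0" using t vt[of t] v13 by (cases "t = 0 \<or> t = D") auto
    have d12: "(?d 1 has_real_derivative ?d 2 p) (at p within {0..D})" if "p \<in> {0..D}" for p
    proof -
      have "?d 1 differentiable (at p within {0..D})"
        using diff[of 1] that by (simp add: differentiable_on_def)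
      then show ?thesis
        by (simp add: vector_derivative_works has_real_derivative_iff_has_vector_derivative
            numeral_2_eq_2)
    qed
    have c2: "continuous_on {0..D} (?d 2)"
      using diff[of 2] by (simp add: differentiable_imp_continuous_on)
    have v2t: "v2 t = 0"
    proof (cases "0 < t \<and> t < D")
      case True
      then show ?thesis using vt[of t] t d2 by simp
    next
      case False
      have "\<exists>k. ((\<lambda>x. (x - t) * h x) \<longlongrightarrow> k) (at t within {0<..<D})"
      proof (cases "t = 0")
        case True
        then have "at t within {0<..<D} \<le> at_right 0" by (auto intro: at_le)
        from tendsto_mono[OF this assms(10)] show ?thesis using True by auto
      next
        case f: False
        have "((\<lambda>x. - ((D - x) * h x)) \<longlongrightarrow> - (- real j)) (at_left D)"
          using assms(11) by (rule tendsto_minus)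
        then have "((\<lambda>x. (x - D) * h x) \<longlongrightarrow> real j) (at_left D)"
          by (simp add: algebra_simps)
        moreover have D: "t = D" using f False t by auto
        moreover have "at t within {0<..<D} \<le> at_left D" unfolding D by (rule at_le) auto
        ultimately show ?thesis using tendsto_mono by blast
      qed
      then obtain k where "((\<lambda>x. (x - t) * h x) \<longlongrightarrow> k) (at t within {0<..<D})" ..
      from radial_laplacian_zero[OF d12[OF t(1)] t(2) d2 c2 cont(3) t(1) assms(1) this]
      show ?thesis using vt by simp
    qed
    \<comment> \<open>The sign of \<open>u - 1\<close> at \<open>t\<close> chooses \<open>s\<close>, the sign of \<open>s * v3 t\<close> the direction; at an end point
      \<open>v3\<close> vanishes and the only available direction works.\<close>
    obtain s :: real where s: "s = 1 \<or> s = -1" "0 \<le> s * (v0 t - 1)" using sgn by blast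
    show False
    proof (cases "t < D \<and> 0 \<le> s * v3 t")
      case True
      then show False using equilibrium_forward[of t s] s t v1t v2t no by auto
    next
      case False
      then have "0 < t" "s * v3 t \<le> 0" using v13 t assms(1) by (cases "t = 0 \<or> t = D"; force)+
      then show False using equilibrium_backward[of t s] s t v1t v2t no by auto
    qed
  qed
  ultimately show ?thesis by blast
qed

end
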